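(* Let $N\ge1$, $s\in(0,1)$, let $\mu_0\in\mathcal{M}^+_s$ and let $u(t,x)=\int_{\mathbb{R}^N}P^t(x-y)\,\mathrm{d}\mu_0(y)$ be the very weak solution of $\partial_t u+(-\Delta)^s u=0$ with initial measure $\mu_0$. Set $\|\mu_0\|_\Phi=\int_{\mathbb{R}^N}\Phi\,\mathrm{d}\mu_0$. There exists a constant $C=C(N,s)$ such that for every $t>0$ and $x\in\mathbb{R}^N$ $$u(t,x)\le C\,\|\mu_0\|_\Phi\,\big(t^{-N/(2s)}+t\big)\,(1+|x|)^{N+2s}.$$
   Context: $(-\Delta)^s$ denotes the fractional Laplacian on $\mathbb{R}^N$ (Fourier multiplier $|\xi|^{2s}$). $P^t$ ($t>0$) is the fractional heat kernel, the function on $\mathbb{R}^N$ whose Fourier transform is $e^{-t|\xi|^{2s}}$. The weight $\Phi$ is defined by $\Phi(x)=1$ for $|x|\le1$ and $\Phi(x)=(1+(|x|^2-1)^4)^{-(N+2s)/8}$ for $|x|\ge1$. $\mathcal{M}^+_s$ is the class of nonnegative Radon measures $\mu$ on $\mathbb{R}^N$ with $\int(1+|x|)^{-(N+2s)}\,\mathrm{d}\mu(x)<\infty$. *)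

theory Defs
  imports "HOL-Analysis.Analysis"
begin

text \<open>Fractional heat kernel P^t, given by Fourier inversion of exp(-t |xi|^(2s)):
  P^t(x) = (2 pi)^(-N) * integral of exp(i x.xi) exp(-t|xi|^(2s)) d xi;
  since the multiplier is even and real, this is the cosine integral below.\<close>
definition frac_heat_kernel :: "real \<Rightarrow> real \<Rightarrow> 'a::euclidean_space \<Rightarrow> real" where
  "frac_heat_kernel s t x =
     (2 * pi) powr (- real DIM('a)) *
     (\<integral>\<xi>. exp (- t * norm \<xi> powr (2 * s)) * cos (x \<bullet> \<xi>) \<partial>(lborel :: 'a measure))"

definition Phi_weight :: "real \<Rightarrow> 'a::euclidean_space \<Rightarrow> real" where
  "Phi_weight s x = (if norm x \<le> 1 then 1
     else (1 + (norm x ^ 2 - 1) ^ 4) powr (- (real DIM('a) + 2 * s) / 8))"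

definition Mplus_s :: "real \<Rightarrow> 'a::euclidean_space measure set" where
  "Mplus_s s = {\<mu>. sets \<mu> = sets borel \<and>
      (\<forall>K. compact K \<longrightarrow> emeasure \<mu> K < \<infinity>) \<and>
      (\<integral>\<^sup>+ x. ennreal ((1 + norm x) powr (- (real DIM('a) + 2 * s))) \<partial>\<mu>) < \<infinity>}"

definition frac_heat_sol :: "real \<Rightarrow> 'a::euclidean_space measure \<Rightarrow> real \<Rightarrow> 'a \<Rightarrow> real" where
  "frac_heat_sol s \<mu> t x = (\<integral>y. frac_heat_kernel s t (x - y) \<partial>\<mu>)"

definition Phi_norm :: "real \<Rightarrow> 'a::euclidean_space measure \<Rightarrow> real" where
  "Phi_norm s \<mu> = (\<integral>x. Phi_weight s x \<partial>\<mu>)"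

end

theory Submission
  imports Defs "HOL-Probability.Characteristic_Functions" "HOL-Real_Asymp.Real_Asymp"
begin

text \<open>
  The theorem follows from the kernel bound \<open>P\<^sup>t(z) \<le> C min (t powr (- N / 2s)) (t |z| powr (- N - 2s))\<close>,
  because \<open>\<Phi>(y) \<ge> (1 + |y|) powr (- N - 2s)\<close> and \<open>1 + |y| \<le> (1 + |x|) (1 + |x - y|)\<close>.
  The bound \<open>t powr (- N / 2s)\<close> is scaling. For the decay in \<open>z\<close>, the multiplier \<open>exp (- t l powr s)\<close>
  with \<open>l = |\<xi>|\<^sup>2\<close> is a limit of positive mixtures of Gaussians \<open>exp (- u l)\<close> (subordination), since
  \<open>l powr s\<close> is a multiple of the integral of \<open>(1 - exp (- v l)) v powr (- 1 - s)\<close> over \<open>v > 0\<close>.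
  The Fourier integral of a single Gaussian at a point \<open>x\<close> is at most
  \<open>C |x| powr (- N) (1 - exp (- u / |x|\<^sup>2))\<close>; this inequality is linear in the multiplier \<open>f\<close>, namely
  \<open>C |x| powr (- N) (f 0 - f (1 / |x|\<^sup>2))\<close>, and so passes to mixtures and limits. For
  \<open>f l = exp (- t l powr s)\<close> it gives \<open>C t |x| powr (- N - 2s)\<close>.
\<close>

section \<open>Fourier transforms of Gaussians\<close>

text \<open>Substituting \<open>c * y\<close> with \<open>c = sqrt (2 * u)\<close> turns the
  Gaussian into the standard normal density, so the integral is read off from the characteristic
  function of that distribution at \<open>a / c\<close>.\<close>

lemma gaussian_fourier_real:
  fixes u a :: real
  assumes u: "0 < u"
  shows "integrable lborel (\<lambda>y. complex_of_real (exp (- u * y\<^sup>2)) * iexp (a * y))"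
    and "(\<integral>y. complex_of_real (exp (- u * y\<^sup>2)) * iexp (a * y) \<partial>lborel)
           = complex_of_real (sqrt (pi / u) * exp (- (a\<^sup>2 / (4 * u))))"
proof -
  define c where "c = sqrt (2 * u)"
  have c: "c > 0" "c\<^sup>2 = 2 * u" using u by (auto simp: c_def)
  define h where "h = (\<lambda>y. complex_of_real (std_normal_density y) * iexp ((a / c) * y))"
  have h_int: "integrable lborel h"
  proof -
    have "integrable lborel (\<lambda>y. complex_of_real (std_normal_density y))"
      by (intro integrable_of_real integrable_normal_density) simp
    then show ?thesis
      by (rule Bochner_Integration.integrable_bound) (auto simp: h_def norm_mult)
  qed
  have h_val: "(\<integral>y. h y \<partial>lborel) = complex_of_real (exp (- ((a / c)\<^sup>2) / 2))"
  proof -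
    have "(\<integral>y. h y \<partial>lborel) = char std_normal_distribution (a / c)"
      unfolding char_def h_def
      by (subst integral_density) (auto simp: scaleR_conv_of_real)
    then show ?thesis by (simp add: char_std_normal_distribution)
  qed
  have eq: "complex_of_real (exp (- u * y\<^sup>2)) * iexp (a * y) = complex_of_real (sqrt (2 * pi)) * h (0 + c * y)" for y
  proof -
    have "(c * y)\<^sup>2 = 2 * u * y\<^sup>2" by (simp add: power_mult_distrib c)
    moreover have "a / c * (c * y) = a * y" using c by simp
    ultimately show ?thesis
      unfolding h_def std_normal_density_def by (simp only: add_0_left) (simp flip: of_real_mult)
  qed
  show "integrable lborel (\<lambda>y. complex_of_real (exp (- u * y\<^sup>2)) * iexp (a * y))"
    unfolding eq using h_int c by (intro integrable_mult_right lborel_integrable_real_affine) auto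
  have "(\<integral>y. h y \<partial>lborel) = c *\<^sub>R (\<integral>y. h (0 + c * y) \<partial>lborel)"
    using lborel_integral_real_affine[of c h 0] c by simp
  then have "(\<integral>y. h (0 + c * y) \<partial>lborel) = complex_of_real (exp (- ((a / c)\<^sup>2) / 2) / c)"
    using c h_val by (simp add: scaleR_conv_of_real field_simps)
  moreover have "sqrt (2 * pi) / c = sqrt (pi / u)"
    using u by (simp add: c_def real_sqrt_divide[symmetric])
  moreover have "(a / c)\<^sup>2 / 2 = a\<^sup>2 / (4 * u)"
    by (simp add: power_divide c)
  ultimately show "(\<integral>y. complex_of_real (exp (- u * y\<^sup>2)) * iexp (a * y) \<partial>lborel)
           = complex_of_real (sqrt (pi / u) * exp (- (a\<^sup>2 / (4 * u))))"
    unfolding eq by (simp flip: of_real_mult of_real_divide) (metis times_divide_eq_left)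
qed

text \<open>Lebesgue measure is the image of the product of one-dimensional Lebesgue measures over
  \<open>Basis\<close>, and a Gaussian times a complex exponential splits into factors of one
  coordinate each. A cosine of a sum does not split, hence the complex form.\<close>

lemma gaussian_fourier_complex:
  fixes x :: "'a::euclidean_space"
  assumes u: "0 < u"
  shows "integrable lborel (\<lambda>\<xi>. complex_of_real (exp (- u * (norm \<xi>)\<^sup>2)) * iexp (x \<bullet> \<xi>))"
    and "(\<integral>\<xi>. complex_of_real (exp (- u * (norm \<xi>)\<^sup>2)) * iexp (x \<bullet> \<xi>) \<partial>lborel)
           = complex_of_real (sqrt (pi / u) ^ DIM('a) * exp (- ((norm x)\<^sup>2 / (4 * u))))"
proof -
  interpret product_sigma_finite "\<lambda>b::'a. lborel :: real measure" ..
  let ?T = "\<lambda>f. \<Sum>b\<in>Basis. f b *\<^sub>R (b::'a)"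
  define F where "F = (\<lambda>\<xi>::'a. complex_of_real (exp (- u * (norm \<xi>)\<^sup>2)) * iexp (x \<bullet> \<xi>))"
  define g where "g = (\<lambda>(b::'a) y. complex_of_real (exp (- u * y\<^sup>2)) * iexp ((x \<bullet> b) * y))"
  have [measurable]: "F \<in> borel_measurable borel" unfolding F_def by measurable
  have T: "?T \<in> measurable (\<Pi>\<^sub>M b\<in>Basis. (lborel :: real measure)) borel"
    by measurable
  have eq: "F (?T f) = (\<Prod>b\<in>Basis. g b (f b))" for f
  proof -
    have n: "(norm (?T f))\<^sup>2 = (\<Sum>b\<in>Basis. (f b)\<^sup>2)"
      unfolding power2_norm_eq_inner euclidean_inner[of "?T f" "?T f"]
      by (simp add: power2_eq_square)
    have i: "x \<bullet> ?T f = (\<Sum>b\<in>Basis. (x \<bullet> b) * f b)"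
      by (simp add: inner_sum_right mult.commute)
    show ?thesis
      unfolding F_def g_def n i
      by (simp add: prod.distrib exp_sum sum_distrib_left flip: of_real_prod sum_negf)
  qed
  have gi: "integrable lborel (g b)" for b
    unfolding g_def by (rule gaussian_fourier_real(1)[OF u])
  have "integrable (\<Pi>\<^sub>M b\<in>Basis. lborel) (\<lambda>f. F (?T f))"
    unfolding eq by (rule product_integrable_prod) (auto intro: gi)
  then have "integrable lborel F"
    by (subst lborel_eq) (simp add: integrable_distr_eq[OF T])
  then show "integrable lborel (\<lambda>\<xi>. complex_of_real (exp (- u * (norm \<xi>)\<^sup>2)) * iexp (x \<bullet> \<xi>))"
    by (simp add: F_def)
  have "(\<integral>\<xi>. F \<xi> \<partial>lborel) = (\<integral>f. F (?T f) \<partial>(\<Pi>\<^sub>M b\<in>Basis. lborel))"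
    by (subst lborel_eq) (simp add: integral_distr[OF T])
  also have "\<dots> = (\<Prod>b\<in>Basis. \<integral>y. g b y \<partial>lborel)"
    unfolding eq by (rule product_integral_prod) (auto intro: gi)
  also have "\<dots> = (\<Prod>b\<in>Basis. complex_of_real (sqrt (pi / u) * exp (- ((x \<bullet> b)\<^sup>2 / (4 * u)))))"
    unfolding g_def by (simp only: gaussian_fourier_real(2)[OF u])
  also have "\<dots> = complex_of_real (sqrt (pi / u) ^ DIM('a) * (\<Prod>b\<in>Basis. exp (- ((x \<bullet> b)\<^sup>2 / (4 * u)))))"
    by (simp only: flip: of_real_prod) (simp add: prod.distrib)
  also have "(\<Prod>b\<in>Basis. exp (- ((x \<bullet> b)\<^sup>2 / (4 * u)))) = exp (- ((norm x)\<^sup>2 / (4 * u)))"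
    unfolding power2_norm_eq_inner euclidean_inner[of x x]
    by (simp add: exp_sum power2_eq_square sum_divide_distrib flip: sum_negf)
  finally show "(\<integral>\<xi>. complex_of_real (exp (- u * (norm \<xi>)\<^sup>2)) * iexp (x \<bullet> \<xi>) \<partial>lborel)
           = complex_of_real (sqrt (pi / u) ^ DIM('a) * exp (- ((norm x)\<^sup>2 / (4 * u))))"
    by (simp add: F_def)
qed

lemma gaussian_integrable:
  assumes "0 < u"
  shows "integrable lborel (\<lambda>\<xi>::'a::euclidean_space. exp (- u * (norm \<xi>)\<^sup>2))"
  using integrable_Re[OF gaussian_fourier_complex(1)[OF assms, of "0::'a"]] by simp

lemma gaussian_fourier_cos:
  fixes x :: "'a::euclidean_space"
  assumes "0 < u"
  shows "(\<integral>\<xi>. exp (- u * (norm \<xi>)\<^sup>2) * cos (x \<bullet> \<xi>) \<partial>lborel)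
           = sqrt (pi / u) ^ DIM('a) * exp (- ((norm x)\<^sup>2 / (4 * u)))"
proof -
  have "exp (- u * (norm \<xi>)\<^sup>2) * cos (x \<bullet> \<xi>)
      = Re (complex_of_real (exp (- u * (norm \<xi>)\<^sup>2)) * iexp (x \<bullet> \<xi>))" for \<xi>
    by (simp add: Re_exp)
  then show ?thesis
    using integral_Re[OF gaussian_fourier_complex(1)[OF assms, of x]]
    by (simp only: gaussian_fourier_complex(2)[OF assms, of x] Re_complex_of_real)
qed

text \<open>Put \<open>z = 1 / w\<close>. Since \<open>1 - exp (- w)\<close> is at least
  \<open>w / (1 + w) = 1 / (1 + z)\<close>, it suffices that the left-hand side times
  \<open>z + 1\<close> stays bounded, and \<open>exp (- (z / 4))\<close> beats every power of
  \<open>z\<close>.\<close>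

lemma gaussian_le_one_minus_exp:
  "\<exists>K\<ge>0. \<forall>w>0. sqrt (pi / w) ^ n * exp (- (1 / (4 * w))) \<le> K * (1 - exp (- w))"
proof -
  define h where "h = (\<lambda>z::real. sqrt (pi * z) ^ n * exp (- (z / 4)) * (z + 1))"
  have "(h \<longlongrightarrow> 0) at_top"
    unfolding h_def by real_asymp
  then have "eventually (\<lambda>z. h z < 1) at_top"
    by (rule order_tendstoD) simp
  then obtain Z where Z: "\<And>z. z \<ge> Z \<Longrightarrow> h z < 1"
    by (auto simp: eventually_at_top_linorder)
  define Y where "Y = max Z 0"
  \<comment> \<open>The summand 1 bounds \<open>h\<close> beyond \<open>Y\<close>; the other one
    bounds it on \<open>[0, Y]\<close>, where the exponential is replaced by 1 and the remaining
    factors are increasing.\<close>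
  define K where "K = 1 + sqrt (pi * Y) ^ n * (Y + 1)"
  have K: "h z \<le> K" if z: "z \<ge> 0" for z
  proof (cases "z \<ge> Y")
    case True
    then show ?thesis using Z[of z] by (auto simp: K_def Y_def intro!: add_increasing2)
  next
    case False
    then have "h z \<le> sqrt (pi * Y) ^ n * 1 * (Y + 1)"
      unfolding h_def using z
      by (intro mult_mono power_mono real_sqrt_le_mono) (auto simp: Y_def)
    then show ?thesis by (simp add: K_def)
  qed
  have "sqrt (pi / w) ^ n * exp (- (1 / (4 * w))) \<le> K * (1 - exp (- w))" if w: "w > 0" for w
  proof -
    have "h (1 / w) \<le> K" using w by (intro K) auto
    then have "sqrt (pi / w) ^ n * exp (- (1 / (4 * w))) * ((1 + w) / w) \<le> K"
      using w by (simp add: h_def field_simps)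
    then have 1: "sqrt (pi / w) ^ n * exp (- (1 / (4 * w))) \<le> K * (w / (1 + w))"
      using w by (simp add: field_simps)
    have "exp (- w) \<le> 1 / (1 + w)"
      using w exp_ge_add_one_self[of w] by (simp add: exp_minus field_simps)
    then have 2: "w / (1 + w) \<le> 1 - exp (- w)"
      using w by (simp add: field_simps)
    have "0 \<le> K" by (simp add: K_def Y_def)
    from 1 mult_left_mono[OF 2 this] show ?thesis by linarith
  qed
  moreover have "0 \<le> K" by (simp add: K_def Y_def)
  ultimately show ?thesis by blast
qed

section \<open>Positive mixtures of Gaussians\<close>

text \<open>Here \<open>f\<close> is a multiplier as a function of \<open>l = |\<xi>|^2\<close>.
  With \<open>g l = exp (- u * l) * f l\<close> the estimate bounds the Fourier integral of
  \<open>g\<close> by \<open>K * (g 0 - g (1 / |x|^2))\<close>. The Gaussian factor makes the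
  integral converge for bounded \<open>f\<close>, and the bounds by \<open>f 0\<close> supply the
  dominating functions.\<close>

definition gaussian_dominated :: "'a::euclidean_space \<Rightarrow> real \<Rightarrow> (real \<Rightarrow> real) \<Rightarrow> bool" where
  "gaussian_dominated x K f \<longleftrightarrow> f \<in> borel_measurable borel \<and>
     (\<forall>l\<ge>0. 0 \<le> f l \<and> f l \<le> f 0) \<and>
     (\<forall>u>0. (\<integral>\<xi>. exp (- u * (norm \<xi>)\<^sup>2) * f ((norm \<xi>)\<^sup>2) * cos (x \<bullet> \<xi>) \<partial>lborel)
        \<le> K * (f 0 - exp (- u / (norm x)\<^sup>2) * f (1 / (norm x)\<^sup>2)))"

lemma gaussian_mult_integrable:
  fixes x :: "'a::euclidean_space"
  assumes [measurable]: "f \<in> borel_measurable borel" and f: "\<And>l. l \<ge> 0 \<Longrightarrow> 0 \<le> f l \<and> f l \<le> f 0"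
    and u: "0 < u"
  shows "integrable lborel (\<lambda>\<xi>. exp (- u * (norm \<xi>)\<^sup>2) * f ((norm \<xi>)\<^sup>2) * cos (x \<bullet> \<xi>))"
proof (rule Bochner_Integration.integrable_bound)
  show "integrable lborel (\<lambda>\<xi>::'a. exp (- u * (norm \<xi>)\<^sup>2) * f 0)"
    using gaussian_integrable[OF u] by (rule integrable_mult_left)
  have "\<bar>f ((norm \<xi>)\<^sup>2)\<bar> * \<bar>cos (x \<bullet> \<xi>)\<bar> \<le> \<bar>f 0\<bar> * 1" for \<xi>
    using f[of "(norm \<xi>)\<^sup>2"] by (intro mult_mono) auto
  then show "AE \<xi> in lborel. norm (exp (- u * (norm \<xi>)\<^sup>2) * f ((norm \<xi>)\<^sup>2) * cos (x \<bullet> \<xi>))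
      \<le> norm (exp (- u * (norm \<xi>)\<^sup>2) * f 0)"
    by (auto simp: abs_mult mult.assoc intro!: mult_left_mono)
qed measurable

lemma gaussian_dominated_integrable:
  fixes x :: "'a::euclidean_space"
  assumes "gaussian_dominated x K f" "0 < u"
  shows "integrable lborel (\<lambda>\<xi>. exp (- u * (norm \<xi>)\<^sup>2) * f ((norm \<xi>)\<^sup>2) * cos (x \<bullet> \<xi>))"
  using assms by (intro gaussian_mult_integrable) (auto simp: gaussian_dominated_def)

text \<open>The Fourier integral of a Gaussian is explicit. Writing it in terms of
  \<open>w = u / |x|^2\<close> splits off the factor \<open>|x| powr (- N)\<close> and leaves the
  one-variable inequality \<open>gaussian_le_one_minus_exp\<close>.\<close>

lemma gaussian_dominated_const:
  "\<exists>C\<ge>0. \<forall>x::'a::euclidean_space. x \<noteq> 0 \<longrightarrow>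
     gaussian_dominated x (C * norm x powr (- real DIM('a))) (\<lambda>_. 1)"
proof -
  obtain C where C: "C \<ge> 0"
    "\<And>w. w > 0 \<Longrightarrow> sqrt (pi / w) ^ DIM('a) * exp (- (1 / (4 * w))) \<le> C * (1 - exp (- w))"
    using gaussian_le_one_minus_exp[of "DIM('a)"] by blast
  have "gaussian_dominated x (C * norm x powr (- real DIM('a))) (\<lambda>_. 1)" if x: "x \<noteq> 0" for x :: 'a
    unfolding gaussian_dominated_def
  proof (intro conjI allI impI)
    fix u :: real assume u: "u > 0"
    define r where "r = norm x"
    have r: "r > 0" using x by (simp add: r_def)
    have "sqrt (pi / u) = sqrt (pi / (u / r\<^sup>2)) / r"
      using r u by (simp add: real_sqrt_divide real_sqrt_mult)
    then have "sqrt (pi / u) ^ DIM('a) = sqrt (pi / (u / r\<^sup>2)) ^ DIM('a) * r powr (- real DIM('a))"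
      using r by (simp only: power_divide powr_minus powr_realpow) (simp only: divide_inverse)
    then have "sqrt (pi / u) ^ DIM('a) * exp (- (r\<^sup>2 / (4 * u)))
        = sqrt (pi / (u / r\<^sup>2)) ^ DIM('a) * exp (- (1 / (4 * (u / r\<^sup>2)))) * r powr (- real DIM('a))"
      by simp
    also have "\<dots> \<le> C * (1 - exp (- (u / r\<^sup>2))) * r powr (- real DIM('a))"
      using u r by (intro mult_right_mono C(2)) auto
    finally show "(\<integral>\<xi>. exp (- u * (norm \<xi>)\<^sup>2) * 1 * cos (x \<bullet> \<xi>) \<partial>lborel)
        \<le> C * norm x powr (- real DIM('a)) * (1 - exp (- u / (norm x)\<^sup>2) * 1)"
      using gaussian_fourier_cos[OF u, of x] by (simp add: r_def mult_ac)
  qed auto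
  with C(1) show ?thesis by blast
qed

lemma gaussian_dominated_cmult:
  assumes f: "gaussian_dominated x K f" and c: "0 \<le> c"
  shows "gaussian_dominated x K (\<lambda>l. c * f l)"
  unfolding gaussian_dominated_def
proof (intro conjI allI impI)
  show "(\<lambda>l. c * f l) \<in> borel_measurable borel"
    using f by (auto simp: gaussian_dominated_def)
  fix u :: real assume u: "u > 0"
  have "(\<integral>\<xi>. exp (- u * (norm \<xi>)\<^sup>2) * (c * f ((norm \<xi>)\<^sup>2)) * cos (x \<bullet> \<xi>) \<partial>lborel)
      = c * (\<integral>\<xi>. exp (- u * (norm \<xi>)\<^sup>2) * f ((norm \<xi>)\<^sup>2) * cos (x \<bullet> \<xi>) \<partial>lborel)"
    by (subst integral_mult_right_zero[symmetric]) (simp add: mult_ac)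
  also have "\<dots> \<le> c * (K * (f 0 - exp (- u / (norm x)\<^sup>2) * f (1 / (norm x)\<^sup>2)))"
    using f u c by (intro mult_left_mono) (auto simp: gaussian_dominated_def)
  finally show "(\<integral>\<xi>. exp (- u * (norm \<xi>)\<^sup>2) * (c * f ((norm \<xi>)\<^sup>2)) * cos (x \<bullet> \<xi>) \<partial>lborel)
      \<le> K * (c * f 0 - exp (- u / (norm x)\<^sup>2) * (c * f (1 / (norm x)\<^sup>2)))"
    by (simp add: algebra_simps)
qed (use f c in \<open>auto simp: gaussian_dominated_def intro: mult_left_mono\<close>)

lemma gaussian_dominated_add:
  assumes f: "gaussian_dominated x K f" and g: "gaussian_dominated x K g"
  shows "gaussian_dominated x K (\<lambda>l. f l + g l)"
  unfolding gaussian_dominated_def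
proof (intro conjI allI impI)
  show "(\<lambda>l. f l + g l) \<in> borel_measurable borel"
    using f g by (auto simp: gaussian_dominated_def)
  fix u :: real assume u: "u > 0"
  have "(\<integral>\<xi>. exp (- u * (norm \<xi>)\<^sup>2) * (f ((norm \<xi>)\<^sup>2) + g ((norm \<xi>)\<^sup>2)) * cos (x \<bullet> \<xi>) \<partial>lborel)
      = (\<integral>\<xi>. exp (- u * (norm \<xi>)\<^sup>2) * f ((norm \<xi>)\<^sup>2) * cos (x \<bullet> \<xi>) \<partial>lborel)
      + (\<integral>\<xi>. exp (- u * (norm \<xi>)\<^sup>2) * g ((norm \<xi>)\<^sup>2) * cos (x \<bullet> \<xi>) \<partial>lborel)"
    by (subst Bochner_Integration.integral_add[symmetric])
      (auto simp: algebra_simps intro: gaussian_dominated_integrable[OF f u, simplified]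
         gaussian_dominated_integrable[OF g u, simplified])
  also have "\<dots> \<le> K * (f 0 - exp (- u / (norm x)\<^sup>2) * f (1 / (norm x)\<^sup>2))
      + K * (g 0 - exp (- u / (norm x)\<^sup>2) * g (1 / (norm x)\<^sup>2))"
    using f g u by (intro add_mono) (auto simp: gaussian_dominated_def)
  finally show "(\<integral>\<xi>. exp (- u * (norm \<xi>)\<^sup>2) * (f ((norm \<xi>)\<^sup>2) + g ((norm \<xi>)\<^sup>2)) * cos (x \<bullet> \<xi>) \<partial>lborel)
      \<le> K * (f 0 + g 0 - exp (- u / (norm x)\<^sup>2) * (f (1 / (norm x)\<^sup>2) + g (1 / (norm x)\<^sup>2)))"
    by (simp add: algebra_simps)
qed (use f g in \<open>auto simp: gaussian_dominated_def intro: add_mono\<close>)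

text \<open>The values at 0 control all values on \<open>l \<ge> 0\<close>, so
  \<open>exp (- u * |\<xi>|^2) * B\<close> is an integrable majorant for the left-hand sides. The
  right-hand side involves \<open>F n\<close> at two points only and converges pointwise.\<close>

lemma gaussian_dominated_limit:
  fixes x :: "'a::euclidean_space"
  assumes F: "\<And>n. gaussian_dominated x K (F n)"
    and lim: "\<And>l. l \<ge> 0 \<Longrightarrow> (\<lambda>n. F n l) \<longlonglongrightarrow> f l"
    and B: "\<And>n. F n 0 \<le> B"
    and [measurable]: "f \<in> borel_measurable borel"
  shows "gaussian_dominated x K f"
  unfolding gaussian_dominated_def
proof (intro conjI allI impI)
  have [measurable]: "F n \<in> borel_measurable borel" for n
    using F by (simp add: gaussian_dominated_def)
  have F0: "0 \<le> F n l" "F n l \<le> F n 0" if "l \<ge> 0" for n l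
    using F that by (auto simp: gaussian_dominated_def)
  show "0 \<le> f l" if "l \<ge> 0" for l
    using F0 that by (intro LIMSEQ_le_const[OF lim]) auto
  show "f l \<le> f 0" if "l \<ge> 0" for l
    using F0 that by (intro LIMSEQ_le[OF lim lim]) auto
  fix u :: real assume u: "u > 0"
  have "(\<lambda>n. \<integral>\<xi>. exp (- u * (norm \<xi>)\<^sup>2) * F n ((norm \<xi>)\<^sup>2) * cos (x \<bullet> \<xi>) \<partial>lborel) \<longlonglongrightarrow>
      (\<integral>\<xi>. exp (- u * (norm \<xi>)\<^sup>2) * f ((norm \<xi>)\<^sup>2) * cos (x \<bullet> \<xi>) \<partial>lborel)"
  proof (rule integral_dominated_convergence)
    show "integrable lborel (\<lambda>\<xi>::'a. exp (- u * (norm \<xi>)\<^sup>2) * B)"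
      using gaussian_integrable[OF u] by (rule integrable_mult_left)
    show "AE \<xi> in lborel. (\<lambda>n. exp (- u * (norm \<xi>)\<^sup>2) * F n ((norm \<xi>)\<^sup>2) * cos (x \<bullet> \<xi>))
        \<longlonglongrightarrow> exp (- u * (norm \<xi>)\<^sup>2) * f ((norm \<xi>)\<^sup>2) * cos (x \<bullet> \<xi>)"
      by (auto intro!: tendsto_intros lim)
    have "\<bar>F n ((norm \<xi>)\<^sup>2)\<bar> * \<bar>cos (x \<bullet> \<xi>)\<bar> \<le> B * 1" for n \<xi>
      using F0[of "(norm \<xi>)\<^sup>2" n] B[of n] by (intro mult_mono) auto
    then show "AE \<xi> in lborel. norm (exp (- u * (norm \<xi>)\<^sup>2) * F n ((norm \<xi>)\<^sup>2) * cos (x \<bullet> \<xi>))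
        \<le> exp (- u * (norm \<xi>)\<^sup>2) * B" for n
      by (auto simp: abs_mult mult.assoc intro!: mult_left_mono)
  qed measurable
  moreover have "(\<lambda>n. K * (F n 0 - exp (- u / (norm x)\<^sup>2) * F n (1 / (norm x)\<^sup>2)))
      \<longlonglongrightarrow> K * (f 0 - exp (- u / (norm x)\<^sup>2) * f (1 / (norm x)\<^sup>2))"
    by (intro tendsto_intros lim) auto
  ultimately show "(\<integral>\<xi>. exp (- u * (norm \<xi>)\<^sup>2) * f ((norm \<xi>)\<^sup>2) * cos (x \<bullet> \<xi>) \<partial>lborel)
        \<le> K * (f 0 - exp (- u / (norm x)\<^sup>2) * f (1 / (norm x)\<^sup>2))"
    using F u by (intro LIMSEQ_le) (auto simp: gaussian_dominated_def)
qed measurable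

lemma integrable_mult_exp:
  assumes w: "integrable lborel w" and supp: "\<And>v. v < 0 \<Longrightarrow> w v = 0" and l: "0 \<le> (l::real)"
  shows "integrable lborel (\<lambda>v. w v * exp (- v * l) :: real)"
proof (rule Bochner_Integration.integrable_bound[OF w])
  have [measurable]: "w \<in> borel_measurable borel" using borel_measurable_integrable[OF w] by simp
  show "(\<lambda>v. w v * exp (- v * l)) \<in> borel_measurable lborel" by measurable
  have "\<bar>w v\<bar> * exp (- v * l) \<le> \<bar>w v\<bar>" for v
    using supp[of v] l by (cases "v < 0") (auto intro!: mult_right_le_one_le)
  then show "AE v in lborel. norm (w v * exp (- v * l)) \<le> norm (w v)"
    by (simp add: abs_mult)
qed

text \<open>Multiplication by \<open>exp (- v l)\<close> only shifts \<open>u\<close> to \<open>u + v\<close>, which is why the definition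
  quantifies over all \<open>u > 0\<close>.\<close>

lemma gaussian_dominated_laplace_mult:
  fixes x :: "'a::euclidean_space" and w :: "real \<Rightarrow> real"
  assumes f: "gaussian_dominated x K f"
    and w: "integrable lborel w" and w0: "\<And>v. 0 \<le> w v" and supp: "\<And>v. v < 0 \<Longrightarrow> w v = 0"
  shows "gaussian_dominated x K (\<lambda>l. (\<integral>v. w v * exp (- v * l) \<partial>lborel) * f l)"
  unfolding gaussian_dominated_def
proof (intro conjI allI impI)
  have [measurable]: "w \<in> borel_measurable borel" using borel_measurable_integrable[OF w] by simp
  have [measurable]: "f \<in> borel_measurable borel" using f by (simp add: gaussian_dominated_def)
  have f0: "0 \<le> f l" "f l \<le> f 0" if "l \<ge> 0" for l
    using f that by (auto simp: gaussian_dominated_def)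
  define m where "m = (\<lambda>l. \<integral>v. w v * exp (- v * l) \<partial>lborel)"
  note wi = integrable_mult_exp[OF w supp]
  have m_le: "0 \<le> m l" "m l \<le> m 0" if "l \<ge> 0" for l
  proof -
    show "0 \<le> m l" unfolding m_def by (intro integral_nonneg_AE) (auto simp: w0)
    have "w v * exp (- v * l) \<le> w v * exp (- v * 0)" for v
      using supp[of v] w0[of v] that by (cases "v < 0") (auto intro!: mult_right_le_one_le)
    then show "m l \<le> m 0"
      unfolding m_def using wi[of l] wi[of 0] that by (intro integral_mono) auto
  qed
  show "(\<lambda>l. (\<integral>v. w v * exp (- v * l) \<partial>lborel) * f l) \<in> borel_measurable borel"
    by measurable
  show "0 \<le> m l * f l" if "l \<ge> 0" for l
    using m_le f0 that by simp
  show "m l * f l \<le> m 0 * f 0" if "l \<ge> 0" for l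
    using m_le f0 that by (intro mult_mono) auto
  fix u :: real assume u: "u > 0"
  \<comment> \<open>\<open>G\<close> is the integrand of the double integral to which Fubini
    applies, and \<open>H\<close> is its majorant in product form: for \<open>v \<ge> 0\<close> the
    factor \<open>exp (- v * |\<xi>|^2)\<close> is at most 1, and for \<open>v < 0\<close> both
    vanish with \<open>w v\<close>.\<close>
  define G where "G = (\<lambda>v (\<xi>::'a). w v * (exp (- (u + v) * (norm \<xi>)\<^sup>2) * f ((norm \<xi>)\<^sup>2) * cos (x \<bullet> \<xi>)))"
  define H where "H = (\<lambda>v (\<xi>::'a). w v * (exp (- u * (norm \<xi>)\<^sup>2) * f 0))"
  have gi: "integrable lborel (\<lambda>\<xi>::'a. exp (- u * (norm \<xi>)\<^sup>2) * f 0)"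
    using gaussian_integrable[OF u] by (rule integrable_mult_left)
  have "integrable (lborel \<Otimes>\<^sub>M lborel) (case_prod H)"
  proof (rule lborel_pair.Fubini_integrable)
    show "case_prod H \<in> borel_measurable (lborel \<Otimes>\<^sub>M lborel)"
      unfolding H_def by measurable
    show "AE v in lborel. integrable lborel (\<lambda>\<xi>. case_prod H (v, \<xi>))"
      using gi by (auto simp: H_def intro!: integrable_mult_right)
    have "(\<integral>\<xi>. norm (case_prod H (v, \<xi>)) \<partial>lborel) = w v * integral\<^sup>L lborel (\<lambda>\<xi>::'a. exp (- u * (norm \<xi>)\<^sup>2) * f 0)" for v
      using w0[of v] f0[of 0] by (simp add: H_def abs_mult)
    then show "integrable lborel (\<lambda>v. \<integral>\<xi>. norm (case_prod H (v, \<xi>)) \<partial>lborel)"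
      using w by simp
  qed
  then have Gi: "integrable (lborel \<Otimes>\<^sub>M lborel) (case_prod G)"
  proof (rule Bochner_Integration.integrable_bound)
    show "case_prod G \<in> borel_measurable (lborel \<Otimes>\<^sub>M lborel)"
      unfolding G_def by measurable
    have "\<bar>G v \<xi>\<bar> \<le> \<bar>H v \<xi>\<bar>" for v \<xi>
    proof (cases "v < 0")
      case True then show ?thesis by (simp add: G_def supp)
    next
      case False
      have "\<bar>exp (- (u + v) * (norm \<xi>)\<^sup>2)\<bar> * \<bar>f ((norm \<xi>)\<^sup>2)\<bar> * \<bar>cos (x \<bullet> \<xi>)\<bar>
          \<le> exp (- u * (norm \<xi>)\<^sup>2) * f 0 * 1"
        using f0[of "(norm \<xi>)\<^sup>2"] f0[of 0] False
        by (intro mult_mono) (auto simp: algebra_simps)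
      then show ?thesis
        using w0[of v] f0[of 0] unfolding G_def H_def abs_mult
        by (intro mult_left_mono) auto
    qed
    then show "AE p in lborel \<Otimes>\<^sub>M lborel. norm (case_prod G p) \<le> norm (case_prod H p)"
      by auto
  qed
  have "(\<integral>\<xi>. exp (- u * (norm \<xi>)\<^sup>2) * (m ((norm \<xi>)\<^sup>2) * f ((norm \<xi>)\<^sup>2)) * cos (x \<bullet> \<xi>) \<partial>lborel)
      = (\<integral>\<xi>. (\<integral>v. G v \<xi> \<partial>lborel) \<partial>lborel)"
  proof (rule Bochner_Integration.integral_cong[OF refl])
    fix \<xi> :: 'a
    have "G v \<xi> = (w v * exp (- v * (norm \<xi>)\<^sup>2)) * (exp (- u * (norm \<xi>)\<^sup>2) * f ((norm \<xi>)\<^sup>2) * cos (x \<bullet> \<xi>))" for v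
      unfolding G_def by (simp add: algebra_simps flip: exp_add)
    then have "(\<integral>v. G v \<xi> \<partial>lborel) = m ((norm \<xi>)\<^sup>2) * (exp (- u * (norm \<xi>)\<^sup>2) * f ((norm \<xi>)\<^sup>2) * cos (x \<bullet> \<xi>))"
      by (simp only: m_def integral_mult_left_zero)
    then show "exp (- u * (norm \<xi>)\<^sup>2) * (m ((norm \<xi>)\<^sup>2) * f ((norm \<xi>)\<^sup>2)) * cos (x \<bullet> \<xi>) = (\<integral>v. G v \<xi> \<partial>lborel)"
      by (simp add: mult_ac)
  qed
  also have "\<dots> = (\<integral>v. (\<integral>\<xi>. G v \<xi> \<partial>lborel) \<partial>lborel)"
    by (rule lborel_pair.Fubini_integral[OF Gi])
  \<comment> \<open>For each fixed \<open>v \<ge> 0\<close> the inner integral is estimated by the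
    hypothesis on \<open>f\<close> with \<open>u + v\<close> in place of \<open>u\<close>; weighting
    by \<open>w v \<ge> 0\<close> keeps the inequality.\<close>
  also have "\<dots> \<le> (\<integral>v. K * (w v * f 0 - (w v * exp (- v * (1 / (norm x)\<^sup>2))) * (exp (- u / (norm x)\<^sup>2) * f (1 / (norm x)\<^sup>2))) \<partial>lborel)"
  proof (rule integral_mono)
    show "integrable lborel (\<lambda>v. \<integral>\<xi>. G v \<xi> \<partial>lborel)"
      using lborel_pair.integrable_fst[OF Gi] .
    show "integrable lborel (\<lambda>v. K * (w v * f 0 - (w v * exp (- v * (1 / (norm x)\<^sup>2))) * (exp (- u / (norm x)\<^sup>2) * f (1 / (norm x)\<^sup>2))))"
      by (intro integrable_mult_right Bochner_Integration.integrable_diff integrable_mult_left w wi) simp_all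
    fix v
    show "(\<integral>\<xi>. G v \<xi> \<partial>lborel) \<le> K * (w v * f 0 - (w v * exp (- v * (1 / (norm x)\<^sup>2))) * (exp (- u / (norm x)\<^sup>2) * f (1 / (norm x)\<^sup>2)))"
    proof (cases "v < 0")
      case True then show ?thesis by (simp add: G_def supp)
    next
      case False
      have "(\<integral>\<xi>. G v \<xi> \<partial>lborel) = w v * (\<integral>\<xi>. exp (- (u + v) * (norm \<xi>)\<^sup>2) * f ((norm \<xi>)\<^sup>2) * cos (x \<bullet> \<xi>) \<partial>lborel)"
        unfolding G_def by (rule integral_mult_right_zero)
      also have "\<dots> \<le> w v * (K * (f 0 - exp (- (u + v) / (norm x)\<^sup>2) * f (1 / (norm x)\<^sup>2)))"
      proof -
        have "u + v > 0" using False u by simp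
        then show ?thesis using f w0[of v] unfolding gaussian_dominated_def
          by (intro mult_left_mono) blast+
      qed
      also have "exp (- (u + v) / (norm x)\<^sup>2) = exp (- v * (1 / (norm x)\<^sup>2)) * exp (- u / (norm x)\<^sup>2)"
        by (simp add: add_divide_distrib diff_divide_distrib flip: exp_add)
      finally show ?thesis by (simp add: algebra_simps)
    qed
  qed
  also have "\<dots> = K * (m 0 * f 0 - exp (- u / (norm x)\<^sup>2) * (m (1 / (norm x)\<^sup>2) * f (1 / (norm x)\<^sup>2)))"
  proof -
    have "(\<integral>v. w v * f 0 - (w v * exp (- v * (1 / (norm x)\<^sup>2))) * (exp (- u / (norm x)\<^sup>2) * f (1 / (norm x)\<^sup>2)) \<partial>lborel)
       = m 0 * f 0 - m (1 / (norm x)\<^sup>2) * (exp (- u / (norm x)\<^sup>2) * f (1 / (norm x)\<^sup>2))"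
    proof (subst Bochner_Integration.integral_diff)
      show "integrable lborel (\<lambda>v. w v * f 0)" by (intro integrable_mult_left w)
      show "integrable lborel (\<lambda>v. (w v * exp (- v * (1 / (norm x)\<^sup>2))) * (exp (- u / (norm x)\<^sup>2) * f (1 / (norm x)\<^sup>2)))"
        by (intro integrable_mult_left wi) simp_all
    qed (simp only: integral_mult_left_zero m_def, simp)
    then show ?thesis by (simp only: integral_mult_right_zero) (simp add: algebra_simps)
  qed
  finally show "(\<integral>\<xi>. exp (- u * (norm \<xi>)\<^sup>2) * (m ((norm \<xi>)\<^sup>2) * f ((norm \<xi>)\<^sup>2)) * cos (x \<bullet> \<xi>) \<partial>lborel)
      \<le> K * (m 0 * f 0 - exp (- u / (norm x)\<^sup>2) * (m (1 / (norm x)\<^sup>2) * f (1 / (norm x)\<^sup>2)))" .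
qed

text \<open>With \<open>m\<close> the Laplace transform of \<open>w\<close>, the multiplier is
  \<open>exp (m l - m 0)\<close>, the Laplace transform of a compound Poisson law with jump
  intensity \<open>w\<close>. Multiplication by \<open>1 + m l / n\<close> preserves domination, and
  \<open>exp (m l)\<close> is the limit of the \<open>n\<close>-th powers of these factors.\<close>

lemma gaussian_dominated_compound_poisson:
  fixes x :: "'a::euclidean_space" and w :: "real \<Rightarrow> real"
  assumes one: "gaussian_dominated x K (\<lambda>_. 1)"
    and w: "integrable lborel w" and w0: "\<And>v. 0 \<le> w v" and supp: "\<And>v. v < 0 \<Longrightarrow> w v = 0"
  shows "gaussian_dominated x K (\<lambda>l. exp (- (\<integral>v. w v * (1 - exp (- v * l)) \<partial>lborel)))"
proof -
  define m where "m = (\<lambda>l. \<integral>v. w v * exp (- v * l) \<partial>lborel)"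
  have [measurable]: "w \<in> borel_measurable borel" using borel_measurable_integrable[OF w] by simp
  have m_meas [measurable]: "m \<in> borel_measurable borel" unfolding m_def by measurable
  have m0: "0 \<le> m l" for l
    unfolding m_def by (intro integral_nonneg_AE) (auto simp: w0)
  have step: "gaussian_dominated x K (\<lambda>l. (1 + m l / real n) ^ k)" for n k
  proof (induction k)
    case 0
    then show ?case using one by simp
  next
    case (Suc k)
    from gaussian_dominated_add[OF Suc gaussian_dominated_cmult[OF gaussian_dominated_laplace_mult[OF Suc w w0 supp], of "1 / real n"]]
    show ?case by (simp add: m_def algebra_simps)
  qed
  have "gaussian_dominated x K (\<lambda>l. exp (m l))"
  proof (rule gaussian_dominated_limit[OF step[of n n for n]])
    show "(\<lambda>n. (1 + m l / real n) ^ n) \<longlonglongrightarrow> exp (m l)" for l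
      by (rule tendsto_exp_limit_sequentially)
    \<comment> \<open>For \<open>n = 0\<close> the power is 1, and the bound holds because
      \<open>m 0\<close> is nonnegative.\<close>
    show "(1 + m 0 / real n) ^ n \<le> exp (m 0)" for n
      using exp_ge_one_plus_x_over_n_power_n[of n "m 0"] m0[of 0] by (cases "n = 0") auto
  qed measurable
  from gaussian_dominated_cmult[OF this, of "exp (- m 0)"]
  have A: "gaussian_dominated x K (\<lambda>l. exp (- m 0) * exp (m l))" by simp
  have eq: "exp (- m 0) * exp (m l) = exp (- (\<integral>v. w v * (1 - exp (- v * l)) \<partial>lborel))" if "l \<ge> 0" for l
  proof -
    have "(\<integral>v. w v * (1 - exp (- v * l)) \<partial>lborel) = m 0 - m l"
      unfolding m_def using integrable_mult_exp[OF w supp that] w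
      by (subst Bochner_Integration.integral_diff[symmetric]) (auto simp: algebra_simps)
    then show ?thesis by (simp flip: exp_add)
  qed
  \<comment> \<open>The limit lemma, applied to a constant sequence, passes to a function known to
    agree only for \<open>l \<ge> 0\<close>. The bound \<open>B = 1\<close> is the value at
    \<open>l = 0\<close>.\<close>
  show ?thesis
    using A by (rule gaussian_dominated_limit[where F = "\<lambda>_. \<lambda>l. exp (- m 0) * exp (m l)" and B = 1])
      (auto simp: eq)
qed

section \<open>Subordination\<close>

text \<open>Up to a constant factor, this is the Levy density of the \<open>s\<close>-stable
  subordinator.\<close>

definition levy_density :: "real \<Rightarrow> real \<Rightarrow> real" where
  "levy_density s v = indicator {0<..} v * v powr (- 1 - s)"

lemma levy_density_measurable [measurable]: "levy_density s \<in> borel_measurable borel"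
  unfolding levy_density_def by measurable

lemma levy_density_nonneg: "0 \<le> levy_density s v"
  by (simp add: levy_density_def)

text \<open>Near 0 the factor \<open>1 - exp (- v)\<close> is at most \<open>v\<close>, which leaves
  \<open>v powr (- s)\<close>, integrable because \<open>s < 1\<close>. Beyond 1 it is at most 1,
  and \<open>v powr (- 1 - s)\<close> is integrable because \<open>s > 0\<close>.\<close>

lemma integrable_levy_density_one:
  assumes s: "0 < s" "s < 1"
  shows "integrable lborel (\<lambda>v. levy_density s v * (1 - exp (- v)))"
proof (rule Bochner_Integration.integrable_bound)
  have "(\<lambda>v::real. v powr (- s)) integrable_on {0..1}"
    by (rule integrable_on_powr_from_0) (use s in auto)
  then have "(\<lambda>v::real. v powr (- s)) absolutely_integrable_on {0..1}"
    by (subst absolutely_integrable_on_iff_nonneg) auto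
  then have 1: "integrable lborel (\<lambda>v. indicator {0..1} v *\<^sub>R v powr (- s))"
    unfolding set_integrable_def by (subst (asm) integrable_completion) auto
  have "(\<lambda>v::real. v powr (- 1 - s)) integrable_on {1..}"
    using has_integral_powr_to_inf[of "- 1 - s" 1] s by (auto simp: integrable_on_def)
  then have "(\<lambda>v::real. v powr (- 1 - s)) absolutely_integrable_on {1..}"
    by (subst absolutely_integrable_on_iff_nonneg) auto
  then have 2: "integrable lborel (\<lambda>v. indicator {1..} v *\<^sub>R v powr (- 1 - s))"
    unfolding set_integrable_def by (subst (asm) integrable_completion) auto
  show "integrable lborel (\<lambda>v. indicator {0..1} v *\<^sub>R v powr (- s) + indicator {1..} v *\<^sub>R v powr (- 1 - s))"
    using 1 2 by (rule Bochner_Integration.integrable_add)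
  have "levy_density s v * (1 - exp (- v)) \<le> indicator {0..1} v *\<^sub>R v powr (- s) + indicator {1..} v *\<^sub>R v powr (- 1 - s)"
    for v
  proof -
    consider "v \<le> 0" | "0 < v" "v < 1" | "1 \<le> v" by linarith
    then show ?thesis
    proof cases
      case 2
      have "v powr (- 1 - s) * (1 - exp (- v)) \<le> v powr (- 1 - s) * v"
        using exp_ge_add_one_self[of "- v"] by (intro mult_left_mono) auto
      also have "\<dots> = v powr (- s)"
        using 2 powr_add[of v "- 1 - s" 1] by simp
      finally show ?thesis using 2 by (simp add: levy_density_def)
    next
      case 3
      then have "v powr (- 1 - s) * (1 - exp (- v)) \<le> v powr (- 1 - s)"
        by (intro mult_right_le_one_le) auto
      moreover have "0 \<le> indicat_real {0..1} v * v powr (- s)" by simp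
      ultimately show ?thesis using 3 by (simp add: levy_density_def add_increasing)
    qed (simp add: levy_density_def)
  qed
  moreover have "0 \<le> levy_density s v * (1 - exp (- v))" for v
    by (cases "v \<le> 0") (auto simp: levy_density_def)
  ultimately show "AE v in lborel. norm (levy_density s v * (1 - exp (- v)))
      \<le> norm (indicator {0..1} v *\<^sub>R v powr (- s) + indicator {1..} v *\<^sub>R v powr (- 1 - s))"
    by auto
qed measurable

text \<open>The density is homogeneous of degree \<open>- 1 - s\<close>. The affine form
  \<open>0 + l * v\<close> matches the substitution rule for Lebesgue integrals on the line.\<close>

lemma levy_density_scaling:
  assumes l: "0 < l"
  shows "levy_density s v * (1 - exp (- v * l))
    = l powr (1 + s) * (levy_density s (0 + l * v) * (1 - exp (- (0 + l * v))))"
proof (cases "v > 0")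
  case True
  have "l powr (1 + s) * (l * v) powr (- 1 - s) = v powr (- 1 - s)"
    using l True powr_add[of l "1 + s" "- 1 - s"] by (simp add: powr_mult)
  then show ?thesis
    using True l by (simp add: levy_density_def mult.commute[of v l] flip: mult.assoc)
next
  case False
  then have "\<not> 0 < l * v" using l by (simp add: zero_less_mult_iff)
  then show ?thesis using False by (simp add: levy_density_def)
qed

text \<open>By homogeneity and the substitution \<open>l * v\<close>, the integral at
  \<open>l\<close> is \<open>l powr s\<close> times its value \<open>J\<close> at
  \<open>l = 1\<close>; hence \<open>c = 1 / J\<close>.\<close>

lemma levy_khintchine_powr:
  assumes s: "0 < s" "s < 1"
  shows "\<exists>c>0. \<forall>l\<ge>0. integrable lborel (\<lambda>v. levy_density s v * (1 - exp (- v * l))) \<and>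
     c * (\<integral>v. levy_density s v * (1 - exp (- v * l)) \<partial>lborel) = l powr s"
proof -
  define g where "g = (\<lambda>v. levy_density s v * (1 - exp (- v)))"
  define J where "J = (\<integral>v. g v \<partial>lborel)"
  have g: "integrable lborel g" unfolding g_def by (rule integrable_levy_density_one[OF s])
  \<comment> \<open>Positivity of \<open>J\<close>: on \<open>[1, 2]\<close> the integrand is at
    least this constant, and elsewhere it is nonnegative.\<close>
  have "0 < (1 - exp (- 1)) * (2::real) powr (- 1 - s)" by simp
  also have "\<dots> = (\<integral>v. indicator {1..2::real} v * ((1 - exp (- 1)) * 2 powr (- 1 - s)) \<partial>lborel)"
    by simp
  also have "\<dots> \<le> J"
    unfolding J_def
  proof (rule integral_mono'[OF g])
    fix v :: real
    show "indicator {1..2} v * ((1 - exp (- 1)) * 2 powr (- 1 - s)) \<le> g v"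
    proof (cases "v \<in> {1..2}")
      case True
      then have "2 powr (- 1 - s) * (1 - exp (- 1)) \<le> v powr (- 1 - s) * (1 - exp (- v))"
        using s by (intro mult_mono powr_mono2') auto
      then show ?thesis using True by (simp add: g_def levy_density_def mult.commute)
    next
      case False
      then show ?thesis by (cases "v \<le> 0") (auto simp: g_def levy_density_def)
    qed
    show "0 \<le> g v" by (cases "v \<le> 0") (auto simp: g_def levy_density_def)
  qed
  finally have J: "J > 0" .
  have "integrable lborel (\<lambda>v. levy_density s v * (1 - exp (- v * l))) \<and>
     1 / J * (\<integral>v. levy_density s v * (1 - exp (- v * l)) \<partial>lborel) = l powr s" if "l \<ge> 0" for l
  \<comment> \<open>At \<open>l = 0\<close> the integrand vanishes, in agreement with
    \<open>0 powr s = 0\<close>.\<close>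
  proof (cases "l = 0")
    case False
    with that have l: "l > 0" by simp
    have eq: "(\<lambda>v. levy_density s v * (1 - exp (- v * l))) = (\<lambda>v. l powr (1 + s) * g (0 + l * v))"
      using levy_density_scaling[OF l] by (auto simp: g_def)
    have "J = l * (\<integral>v. g (0 + l * v) \<partial>lborel)"
      using lborel_integral_real_affine[of l g 0] l by (simp add: J_def)
    then have "(\<integral>v. g (0 + l * v) \<partial>lborel) = J / l" using l by (simp add: field_simps)
    moreover have "l powr (1 + s) = l * l powr s" using l by (simp add: powr_add)
    ultimately show ?thesis
      unfolding eq using J l g
      by (auto intro!: integrable_mult_right lborel_integrable_real_affine[where t = 0, simplified])
  qed simp
  with J show ?thesis by (intro exI[of _ "1 / J"]) simp
qed

text \<open>The Levy density has infinite mass near 0, so it is cut off below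
  \<open>1 / (n + 1)\<close>. Each truncation yields a compound Poisson multiplier, and the
  exponents converge to \<open>t * l powr s\<close> as the cutoff is removed.\<close>

lemma gaussian_dominated_exp_powr:
  fixes x :: "'a::euclidean_space"
  assumes s: "0 < s" "s < 1" and t: "0 < t"
    and one: "gaussian_dominated x K (\<lambda>_. 1)"
  shows "gaussian_dominated x K (\<lambda>l. exp (- t * l powr s))"
proof -
  obtain c where c: "c > 0"
    and ci: "\<And>l. l \<ge> 0 \<Longrightarrow> integrable lborel (\<lambda>v. levy_density s v * (1 - exp (- v * l)))"
    and cv: "\<And>l. l \<ge> 0 \<Longrightarrow> c * (\<integral>v. levy_density s v * (1 - exp (- v * l)) \<partial>lborel) = l powr s"
    using levy_khintchine_powr[OF s] by blast
  define w where "w = (\<lambda>n v. (t * c) * (indicator {1 / real (Suc n)<..} v * levy_density s v))"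
  have w0: "0 \<le> w n v" for n v
    using t c by (auto simp: w_def levy_density_nonneg)
  have supp: "w n v = 0" if "v < 0" for n v
    using that by (simp add: w_def levy_density_def)
  have wi: "integrable lborel (w n)" for n
  proof -
    \<comment> \<open>Beyond the cutoff \<open>1 - exp (- v)\<close> is at least \<open>e\<close>,
      so the truncated density is at most \<open>1 / e\<close> times the integrable function
      \<open>levy_density s v * (1 - exp (- v))\<close>.\<close>
    define e where "e = 1 - exp (- (1 / real (Suc n)))"
    have e: "e > 0" by (simp add: e_def)
    have "integrable lborel (\<lambda>v. indicator {1 / real (Suc n)<..} v * levy_density s v)"
    proof (rule Bochner_Integration.integrable_bound)
      show "integrable lborel (\<lambda>v. (1 / e) * (levy_density s v * (1 - exp (- v * 1))))"
        by (intro integrable_mult_right ci) simp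
      have "indicator {1 / real (Suc n)<..} v * levy_density s v \<le> (1 / e) * (levy_density s v * (1 - exp (- v * 1)))" for v
      proof (cases "v > 1 / real (Suc n)")
        case True
        then have "e \<le> 1 - exp (- v)" by (simp add: e_def)
        then have "levy_density s v * e \<le> levy_density s v * (1 - exp (- v))"
          by (intro mult_left_mono levy_density_nonneg)
        then show ?thesis using True e by (simp add: field_simps)
      next
        case False
        have "0 \<le> levy_density s v * (1 - exp (- v))"
          by (cases "v \<le> 0") (auto simp: levy_density_def)
        then show ?thesis using False e by simp
      qed
      moreover have "0 \<le> indicator {1 / real (Suc n)<..} v * levy_density s v" for v
        by (simp add: levy_density_nonneg)
      ultimately show "AE v in lborel. norm (indicator {1 / real (Suc n)<..} v * levy_density s v)
         \<le> norm ((1 / e) * (levy_density s v * (1 - exp (- v * 1))))"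
        by (auto intro!: AE_I2 order_trans[OF _ abs_ge_self] simp: abs_of_nonneg simp del: times_divide_eq_left)
    qed measurable
    then show ?thesis unfolding w_def by (rule integrable_mult_right)
  qed
  show ?thesis
  proof (rule gaussian_dominated_limit[OF gaussian_dominated_compound_poisson[OF one wi w0 supp]])
    fix l :: real assume l: "l \<ge> 0"
    let ?h = "\<lambda>v. (t * c) * (levy_density s v * (1 - exp (- v * l)))"
    have "(\<lambda>n. \<integral>v. w n v * (1 - exp (- v * l)) \<partial>lborel) \<longlonglongrightarrow> (\<integral>v. ?h v \<partial>lborel)"
    proof (rule integral_dominated_convergence)
      show "integrable lborel (\<lambda>v. norm (?h v))"
        by (intro integrable_norm integrable_mult_right ci l)
      show "AE v in lborel. norm (w n v * (1 - exp (- v * l))) \<le> norm (?h v)" for n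
        by (auto simp: w_def abs_mult indicator_def intro!: AE_I2)
      have "(\<lambda>n. w n v * (1 - exp (- v * l))) \<longlonglongrightarrow> ?h v" for v
      proof (cases "v > 0")
        case True
        have "eventually (\<lambda>n. 1 / real (Suc n) < v) sequentially"
          using True by real_asymp
        then have "eventually (\<lambda>n. w n v * (1 - exp (- v * l)) = ?h v) sequentially"
          by eventually_elim (simp add: w_def)
        then show ?thesis by (rule tendsto_eventually)
      next
        case False
        then show ?thesis by (simp add: w_def levy_density_def)
      qed
      then show "AE v in lborel. (\<lambda>n. w n v * (1 - exp (- v * l))) \<longlonglongrightarrow> ?h v" by simp
    qed (simp_all add: w_def)
    also have "(\<integral>v. ?h v \<partial>lborel) = t * l powr s"
      using cv[OF l] by simp
    finally show "(\<lambda>n. exp (- (\<integral>v. w n v * (1 - exp (- v * l)) \<partial>lborel))) \<longlonglongrightarrow> exp (- t * l powr s)"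
      by (auto intro!: tendsto_intros)
  next
    show "exp (- (\<integral>v. w n v * (1 - exp (- v * 0)) \<partial>lborel)) \<le> 1" for n by simp
  qed measurable
qed

section \<open>Off-diagonal decay of the kernel integral\<close>

text \<open>The regularising factor \<open>exp (- u * |\<xi>|^2)\<close> is removed by letting
  \<open>u\<close> tend to 0 in the domination inequality for \<open>exp (- t * l powr s)\<close>.
  The constant comes from the pure Gaussian case and so depends on the dimension only.\<close>

lemma heat_kernel_integral_decay:
  "\<exists>C\<ge>0. \<forall>s t. \<forall>x::'a::euclidean_space. 0 < s \<longrightarrow> s < 1 \<longrightarrow> 0 < t \<longrightarrow> x \<noteq> 0 \<longrightarrow>
     (\<integral>\<xi>. exp (- t * norm \<xi> powr (2 * s)) * cos (x \<bullet> \<xi>) \<partial>lborel)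
       \<le> C * t * norm x powr (- (real DIM('a) + 2 * s))"
proof -
  obtain C where C: "C \<ge> 0"
    "\<And>x::'a. x \<noteq> 0 \<Longrightarrow> gaussian_dominated x (C * norm x powr (- real DIM('a))) (\<lambda>_. 1)"
    using gaussian_dominated_const by blast
  have "(\<integral>\<xi>. exp (- t * norm \<xi> powr (2 * s)) * cos (x \<bullet> \<xi>) \<partial>lborel)
       \<le> C * t * norm x powr (- (real DIM('a) + 2 * s))" (is "integral\<^sup>L lborel ?P \<le> _")
    if s: "0 < s" "s < 1" and t: "0 < t" and x: "x \<noteq> 0" for s t :: real and x :: 'a
  proof (cases "integrable lborel ?P")
    \<comment> \<open>A non-integrable function has Bochner integral 0 by convention, and the
      claimed bound is nonnegative.\<close>
    case False
    then show ?thesis using C(1) t by (simp add: not_integrable_integral_eq)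
  next
    case True
    define K where "K = C * norm x powr (- real DIM('a))"
    define f where "f = (\<lambda>l. exp (- t * l powr s))"
    define u where "u = (\<lambda>n. 1 / real (Suc n))"
    have u: "u \<longlonglongrightarrow> 0" unfolding u_def by real_asymp
    have u0: "0 < u n" for n by (simp add: u_def)
    have f: "gaussian_dominated x K f"
      unfolding f_def K_def by (rule gaussian_dominated_exp_powr[OF s t C(2)[OF x]])
    have eq: "f ((norm \<xi>)\<^sup>2) = exp (- t * norm \<xi> powr (2 * s))" for \<xi> :: 'a
      by (cases "\<xi> = 0") (simp_all add: f_def powr_powr flip: powr_numeral)
    have "(\<lambda>n. \<integral>\<xi>. exp (- u n * (norm \<xi>)\<^sup>2) * f ((norm \<xi>)\<^sup>2) * cos (x \<bullet> \<xi>) \<partial>lborel) \<longlonglongrightarrow> integral\<^sup>L lborel ?P"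
    proof (rule integral_dominated_convergence)
      show "integrable lborel (\<lambda>\<xi>. norm (?P \<xi>))" using True by (rule integrable_norm)
      show "(\<lambda>\<xi>. exp (- u n * (norm \<xi>)\<^sup>2) * f ((norm \<xi>)\<^sup>2) * cos (x \<bullet> \<xi>)) \<in> borel_measurable lborel" for n
        unfolding f_def by measurable
      have "norm (exp (- u n * (norm \<xi>)\<^sup>2) * f ((norm \<xi>)\<^sup>2) * cos (x \<bullet> \<xi>)) \<le> norm (?P \<xi>)" for n \<xi>
        using u0[of n] unfolding eq by (simp add: abs_mult mult.assoc mult_left_le_one_le)
      then show "AE \<xi> in lborel. norm (exp (- u n * (norm \<xi>)\<^sup>2) * f ((norm \<xi>)\<^sup>2) * cos (x \<bullet> \<xi>)) \<le> norm (?P \<xi>)" for n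
        by simp
      have "(\<lambda>n. exp (- u n * (norm \<xi>)\<^sup>2) * f ((norm \<xi>)\<^sup>2) * cos (x \<bullet> \<xi>)) \<longlonglongrightarrow>
          exp (- 0 * (norm \<xi>)\<^sup>2) * f ((norm \<xi>)\<^sup>2) * cos (x \<bullet> \<xi>)" for \<xi>
        by (intro tendsto_intros u)
      then show "AE \<xi> in lborel. (\<lambda>n. exp (- u n * (norm \<xi>)\<^sup>2) * f ((norm \<xi>)\<^sup>2) * cos (x \<bullet> \<xi>)) \<longlonglongrightarrow> ?P \<xi>"
        by (simp add: eq)
    qed measurable
    moreover have "(\<lambda>n. K * (f 0 - exp (- u n / (norm x)\<^sup>2) * f (1 / (norm x)\<^sup>2)))
        \<longlonglongrightarrow> K * (f 0 - exp (- 0 / (norm x)\<^sup>2) * f (1 / (norm x)\<^sup>2))"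
      using x by (intro tendsto_intros u) simp
    ultimately have "integral\<^sup>L lborel ?P \<le> K * (f 0 - exp (- 0 / (norm x)\<^sup>2) * f (1 / (norm x)\<^sup>2))"
      by (rule LIMSEQ_le) (use f u0 in \<open>auto simp: gaussian_dominated_def\<close>)
    also have "\<dots> = K * (1 - exp (- t * (1 / (norm x)\<^sup>2) powr s))"
      using s by (simp add: f_def)
    \<comment> \<open>The inequality \<open>1 - exp (- a) \<le> a\<close> with
      \<open>a = t * |x| powr (- 2 * s)\<close> produces both the factor \<open>t\<close> and the
      additional decay.\<close>
    also have "\<dots> \<le> K * (t * (1 / (norm x)\<^sup>2) powr s)"
      using exp_ge_add_one_self[of "- t * (1 / (norm x)\<^sup>2) powr s"] C(1)
      by (intro mult_left_mono) (auto simp: K_def)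
    also have "(1 / (norm x)\<^sup>2) powr s = norm x powr (- (2 * s))"
      using x by (simp add: powr_divide powr_powr powr_minus_divide flip: powr_numeral)
    also have "K * (t * norm x powr (- (2 * s))) = C * t * norm x powr (- (real DIM('a) + 2 * s))"
      using powr_add[of "norm x" "- real DIM('a)" "- (2 * s)"] by (simp add: K_def mult_ac)
    finally show ?thesis .
  qed
  with C(1) show ?thesis by blast
qed

section \<open>On-diagonal bound by scaling\<close>

text \<open>On the shell \<open>k \<le> |\<xi>| < k + 1\<close> the function is at most
  \<open>a k\<close>, and the shell lies in a ball whose volume is a multiple of
  \<open>(k + 1) ^ N\<close>. The resulting series converges because \<open>a k\<close> decays
  faster than any power of \<open>k\<close>.\<close>

lemma integrable_exp_norm_powr:
  assumes p: "0 < p"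
  shows "integrable lborel (\<lambda>\<xi>::'a::euclidean_space. exp (- (norm \<xi> powr p)))"
proof (rule integrableI_bounded)
  define a where "a = (\<lambda>k::nat. exp (- (real k powr p)))"
  define V where "V = unit_ball_vol (real DIM('a))"
  have V: "V \<ge> 0" by (simp add: V_def)
  have "(\<integral>\<^sup>+ (\<xi>::'a). ennreal (norm (exp (- (norm \<xi> powr p)))) \<partial>lborel)
      \<le> (\<integral>\<^sup>+ (\<xi>::'a). (\<Sum>k. ennreal (a k) * indicator (ball 0 (real (Suc k))) \<xi>) \<partial>lborel)"
  proof (rule nn_integral_mono)
    fix \<xi> :: 'a
    define k where "k = nat \<lfloor>norm \<xi>\<rfloor>"
    have k: "real k \<le> norm \<xi>" "norm \<xi> < real (Suc k)"
      by (simp_all add: k_def of_nat_floor) linarith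
    have "ennreal (norm (exp (- (norm \<xi> powr p)))) \<le> ennreal (a k) * indicator (ball 0 (real (Suc k))) \<xi>"
      using k p by (auto simp: a_def intro!: ennreal_leI powr_mono2)
    also have "\<dots> \<le> (\<Sum>k. ennreal (a k) * indicator (ball 0 (real (Suc k))) \<xi>)"
    proof -
      have "F k \<le> suminf F" for F :: "nat \<Rightarrow> ennreal"
        using sum_le_suminf[of F "{k}"] by simp
      then show ?thesis .
    qed
    finally show "ennreal (norm (exp (- (norm \<xi> powr p)))) \<le> \<dots>" .
  qed
  also have "\<dots> = (\<Sum>k. ennreal (a k) * emeasure lborel (ball (0::'a) (real (Suc k))))"
    by (subst nn_integral_suminf) (auto simp: nn_integral_cmult_indicator intro!: borel_measurable_times_ennreal borel_measurable_indicator)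
  also have "\<dots> = (\<Sum>k. ennreal (a k * (V * real (Suc k) ^ DIM('a))))"
    unfolding V_def by (subst emeasure_ball) (auto simp: a_def ennreal_mult)
  also have "\<dots> < \<infinity>"
  proof -
    have "summable (\<lambda>k. a k * real (Suc k) ^ DIM('a))"
    proof (rule summable_comparison_test_ev)
      show "summable (\<lambda>k. 1 / real (Suc k) ^ 2)"
        using inverse_power_summable[of 2] summable_Suc_iff[of "\<lambda>n. 1 / real n ^ 2"]
        by (simp add: divide_inverse)
      have "(\<lambda>k::nat. exp (- (real k powr p)) * real (Suc k) ^ DIM('a) * real (Suc k) ^ 2) \<longlonglongrightarrow> 0"
        using p by real_asymp
      then have "eventually (\<lambda>k. exp (- (real k powr p)) * real (Suc k) ^ DIM('a) * real (Suc k) ^ 2 < 1) sequentially"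
        by (rule order_tendstoD) simp
      then show "eventually (\<lambda>k. norm (a k * real (Suc k) ^ DIM('a)) \<le> 1 / real (Suc k) ^ 2) sequentially"
        by eventually_elim (simp add: a_def pos_le_divide_eq del: of_nat_Suc)
    qed
    then have "summable (\<lambda>k. a k * (V * real (Suc k) ^ DIM('a)))"
      using summable_mult[of "\<lambda>k. a k * real (Suc k) ^ DIM('a)" V] by (simp add: mult_ac)
    then show ?thesis
      using V by (subst suminf_ennreal2) (auto simp: a_def)
  qed
  finally show "(\<integral>\<^sup>+ (\<xi>::'a). ennreal (norm (exp (- (norm \<xi> powr p)))) \<partial>lborel) < \<infinity>" .
qed measurable

lemma lborel_scaleR:
  fixes f :: "'a::euclidean_space \<Rightarrow> real"
  assumes f: "integrable lborel f" and c: "0 < c"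
  shows "integrable lborel (\<lambda>x. f (c *\<^sub>R x))"
    and "(\<integral>x. f (c *\<^sub>R x) \<partial>lborel) = (\<integral>x. f x \<partial>lborel) / c ^ DIM('a)"
proof -
  have L: "lborel = density (distr lborel borel (\<lambda>x::'a. c *\<^sub>R x)) (\<lambda>_. ennreal (c ^ DIM('a)))"
    using lborel_affine[of c "0::'a"] c by simp
  have [measurable]: "f \<in> borel_measurable borel" using borel_measurable_integrable[OF f] by simp
  from f have "integrable (density (distr lborel borel (\<lambda>x::'a. c *\<^sub>R x)) (\<lambda>_. ennreal (c ^ DIM('a)))) f"
    by (subst L[symmetric])
  then show "integrable lborel (\<lambda>x. f (c *\<^sub>R x))"
    using c by (simp add: integrable_density integrable_distr_eq)
  have "(\<integral>x. f x \<partial>lborel) = c ^ DIM('a) * (\<integral>x. f (c *\<^sub>R x) \<partial>lborel)"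
    using c by (subst L) (simp add: integral_density integral_distr)
  then show "(\<integral>x. f (c *\<^sub>R x) \<partial>lborel) = (\<integral>x. f x \<partial>lborel) / c ^ DIM('a)"
    using c by simp
qed

text \<open>Since the cosine is at most 1, the integral is largest at \<open>x = 0\<close>. There
  the dilation by \<open>c\<close>, chosen with \<open>c powr (2 * s) = t\<close>, reduces time
  \<open>t\<close> to time 1.\<close>

lemma heat_kernel_integral_le_diagonal:
  fixes x :: "'a::euclidean_space"
  assumes s: "0 < s" and t: "0 < t"
  shows "(\<integral>\<xi>. exp (- t * norm \<xi> powr (2 * s)) * cos (x \<bullet> \<xi>) \<partial>lborel)
     \<le> integral\<^sup>L lborel (\<lambda>\<xi>::'a. exp (- (norm \<xi> powr (2 * s)))) * t powr (- real DIM('a) / (2 * s))"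
proof -
  define c where "c = t powr (1 / (2 * s))"
  have c: "c > 0" "c powr (2 * s) = t" using s t by (auto simp: c_def powr_powr)
  have f: "integrable lborel (\<lambda>\<xi>::'a. exp (- (norm \<xi> powr (2 * s))))"
    by (rule integrable_exp_norm_powr) (use s in simp)
  have eq: "exp (- (norm (c *\<^sub>R \<xi>) powr (2 * s))) = exp (- t * norm \<xi> powr (2 * s))" for \<xi> :: 'a
    using c by (simp add: powr_mult)
  note sc = lborel_scaleR[OF f c(1), unfolded eq]
  have "(\<integral>\<xi>. exp (- t * norm \<xi> powr (2 * s)) * cos (x \<bullet> \<xi>) \<partial>lborel)
      \<le> (\<integral>\<xi>. exp (- t * norm (\<xi>::'a) powr (2 * s)) \<partial>lborel)"
    by (rule integral_mono'[OF sc(1)]) (auto simp: mult_left_le)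
  also have "\<dots> = integral\<^sup>L lborel (\<lambda>\<xi>::'a. exp (- (norm \<xi> powr (2 * s)))) / c ^ DIM('a)"
    by (rule sc(2))
  also have "c ^ DIM('a) = t powr (real DIM('a) / (2 * s))"
    using c(1) by (simp add: c_def powr_powr flip: powr_realpow)
  finally show ?thesis by (simp add: powr_minus_divide)
qed

section \<open>Kernel and weight estimates\<close>

text \<open>For \<open>|z| \<le> 1\<close> the diagonal bound is used with
  \<open>1 + |z| \<le> 2\<close>, for \<open>|z| > 1\<close> the decay bound with
  \<open>1 + |z| \<le> 2 * |z|\<close>. Either case costs a factor \<open>2 powr p\<close>, and the
  sum of the two time factors covers both.\<close>

lemma frac_heat_kernel_le:
  assumes s: "0 < s" "s < 1"
  shows "\<exists>C\<ge>0. \<forall>t>0. \<forall>z::'a::euclidean_space. frac_heat_kernel s t z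
    \<le> C * (t powr (- real DIM('a) / (2 * s)) + t) * (1 + norm z) powr (- (real DIM('a) + 2 * s))"
proof -
  define p where "p = real DIM('a) + 2 * s"
  have p: "p > 0" using s by (simp add: p_def add_nonneg_pos)
  have pos: "0 < (1 + norm v) powr p" for v :: 'a
    using norm_ge_zero[of v] by (simp del: norm_ge_zero)
  define A where "A = integral\<^sup>L lborel (\<lambda>\<xi>::'a. exp (- (norm \<xi> powr (2 * s))))"
  have A: "A \<ge> 0" unfolding A_def by simp
  obtain B where B: "B \<ge> 0" "\<And>t (x::'a). 0 < t \<Longrightarrow> x \<noteq> 0 \<Longrightarrow>
     (\<integral>\<xi>. exp (- t * norm \<xi> powr (2 * s)) * cos (x \<bullet> \<xi>) \<partial>lborel) \<le> B * t * norm x powr (- p)"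
    using heat_kernel_integral_decay[where 'a = 'a] s unfolding p_def by blast
  define D where "D = (2 * pi) powr (- real DIM('a))"
  have D: "D > 0" by (simp add: D_def)
  define C where "C = D * ((A + B) * 2 powr p)"
  have "frac_heat_kernel s t z \<le> C * (t powr (- real DIM('a) / (2 * s)) + t) * (1 + norm z) powr (- p)"
    if t: "t > 0" for t and z :: 'a
  proof -
    define T where "T = t powr (- real DIM('a) / (2 * s))"
    have T: "T > 0" using t by (simp add: T_def)
    define I where "I = (\<integral>\<xi>. exp (- t * norm \<xi> powr (2 * s)) * cos (z \<bullet> \<xi>) \<partial>lborel)"
    have "I \<le> (A + B) * (T + t) * (2 powr p * (1 + norm z) powr (- p))"
    proof (cases "norm z \<le> 1")
      case True
      have "I \<le> A * T * 1"
        using heat_kernel_integral_le_diagonal[OF s(1) t, of z] by (simp add: I_def A_def T_def)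
      also have "\<dots> \<le> (A + B) * (T + t) * (2 powr p * (1 + norm z) powr (- p))"
      proof (intro mult_mono)
        have "(1 + norm z) powr p \<le> 2 powr p"
          using True p by (intro powr_mono2) auto
        then show "1 \<le> 2 powr p * (1 + norm z) powr (- p)"
          by (simp add: powr_minus_divide pos_le_divide_eq[OF pos])
      qed (use A B T t in auto)
      finally show ?thesis .
    next
      case False
      then have "z \<noteq> 0" by auto
      from B(2)[OF t this] have "I \<le> B * t * norm z powr (- p)" by (simp add: I_def)
      also have "\<dots> \<le> (A + B) * (T + t) * (2 powr p * (1 + norm z) powr (- p))"
      proof (intro mult_mono)
        have "(1 + norm z) powr p \<le> (2 * norm z) powr p"
          using False p by (intro powr_mono2) auto
        then show "norm z powr (- p) \<le> 2 powr p * (1 + norm z) powr (- p)"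
          using pos_divide_le_eq[of "norm z powr p"] \<open>z \<noteq> 0\<close>
          by (simp add: powr_minus_divide powr_mult pos_le_divide_eq[OF pos])
      qed (use A B T t in auto)
      finally show ?thesis .
    qed
    then have "D * I \<le> D * ((A + B) * (T + t) * (2 powr p * (1 + norm z) powr (- p)))"
      using D by (intro mult_left_mono) auto
    moreover have "frac_heat_kernel s t z = D * I"
      by (simp only: frac_heat_kernel_def D_def I_def)
    ultimately show ?thesis by (simp add: C_def T_def mult_ac)
  qed
  moreover have "C \<ge> 0" using A B D by (simp add: C_def)
  ultimately show ?thesis unfolding p_def by blast
qed

section \<open>Comparison of the weight with a power of \<open>1 + |y|\<close>\<close>

text \<open>The weight is \<open>b powr (- (p / 8))\<close> with \<open>b\<close> comparable to
  \<open>(1 + r) ^ 8\<close>. The lower bound lets the weight absorb the kernel; the upper bound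
  makes it integrable for measures in \<open>Mplus_s s\<close>.\<close>

lemma Phi_weight_bounds:
  fixes y :: "'a::euclidean_space"
  assumes s: "0 < s"
  defines "p \<equiv> real DIM('a) + 2 * s"
  shows "(1 + norm y) powr (- p) \<le> Phi_weight s y"
    and "Phi_weight s y \<le> 2048 powr (p / 8) * (1 + norm y) powr (- p)"
proof -
  define r where "r = norm y"
  define b where "b = (if r \<le> 1 then 1 else 1 + (r\<^sup>2 - 1) ^ 4)"
  have r: "r \<ge> 0" by (simp add: r_def)
  have p: "p > 0" using s by (simp add: p_def add_nonneg_pos)
  have Phi: "Phi_weight s y = b powr (- (p / 8))"
    unfolding Phi_weight_def b_def r_def p_def by (simp only: minus_divide_left) simp
  have e8: "((1 + r) ^ 8) powr (- (p / 8)) = (1 + r) powr (- p)"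
    using r by (simp add: powr_powr flip: powr_numeral)
  have b: "b > 0" by (auto simp: b_def add_pos_nonneg)
  have bounds: "b \<le> (1 + r) ^ 8 \<and> (1 + r) ^ 8 \<le> 2048 * b"
  proof (cases "r \<le> 1")
    case True
    then have "(1 + r) ^ 8 \<le> 2 ^ 8" using r by (intro power_mono) auto
    then show ?thesis using True r by (simp add: b_def one_le_power)
  next
    case False
    \<comment> \<open>As \<open>(1 + q) ^ 4 = r ^ 8\<close>, it remains to compare
      \<open>(1 + q) ^ 4\<close> with \<open>1 + q ^ 4\<close>. Using \<open>sq\<close> twice costs
      a factor 8, and \<open>1 + r \<le> 2 * r\<close> costs \<open>2 ^ 8 = 256\<close>; their
      product is 2048.\<close>
    define q where "q = r\<^sup>2 - 1"
    have q: "q > 0" using False by (simp add: q_def)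
    have q4: "(1 + q) ^ 4 = r ^ 8" by (simp add: q_def flip: power_mult)
    have "1 + q ^ 4 \<le> (1 + q) ^ 4"
      using q by (simp add: eval_nat_numeral algebra_simps)
    also have "\<dots> \<le> (1 + r) ^ 8" unfolding q4 using r by (intro power_mono) auto
    finally have 1: "b \<le> (1 + r) ^ 8" using False by (simp add: b_def q_def)
    have sq: "(1 + a)\<^sup>2 \<le> 2 * (1 + a\<^sup>2)" for a :: real
      using zero_le_power2[of "1 - a"] by (simp add: power2_eq_square algebra_simps)
    have "(1 + q) ^ 4 = ((1 + q)\<^sup>2)\<^sup>2" by (simp flip: power_mult)
    also have "\<dots> \<le> (2 * (1 + q\<^sup>2))\<^sup>2" by (intro power_mono sq) auto
    also have "\<dots> = 4 * (1 + q\<^sup>2)\<^sup>2" by (simp only: power_mult_distrib) simp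
    also have "\<dots> \<le> 4 * (2 * (1 + (q\<^sup>2)\<^sup>2))" by (intro mult_left_mono sq) auto
    also have "\<dots> = 8 * (1 + q ^ 4)" by (simp flip: power_mult)
    finally have 2: "r ^ 8 \<le> 8 * b" using False by (simp add: q4 b_def q_def)
    have "(1 + r) ^ 8 \<le> (2 * r) ^ 8" using False by (intro power_mono) auto
    also have "\<dots> = 256 * r ^ 8" by (simp add: power_mult_distrib)
    finally show ?thesis using 1 2 by simp
  qed
  have "((1 + r) ^ 8) powr (- (p / 8)) \<le> b powr (- (p / 8))"
    using bounds b p by (intro powr_mono2') auto
  then show "(1 + norm y) powr (- p) \<le> Phi_weight s y"
    unfolding e8 Phi by (simp add: r_def)
  have "(2048 * b) powr (- (p / 8)) \<le> ((1 + r) ^ 8) powr (- (p / 8))"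
    using bounds r p by (intro powr_mono2') auto
  then have "b powr (- (p / 8)) / 2048 powr (p / 8) \<le> (1 + r) powr (- p)"
    unfolding e8 using b by (simp add: powr_mult powr_minus_divide mult.commute)
  then show "Phi_weight s y \<le> 2048 powr (p / 8) * (1 + norm y) powr (- p)"
    unfolding Phi by (simp add: r_def field_simps)
qed

text \<open>\<open>Phi_norm\<close> is a Bochner integral and is meaningful as a bound once the
  weight is integrable; the upper bound on the weight reduces this to the moment condition in
  \<open>Mplus_s\<close>.\<close>

lemma Phi_weight_integrable:
  fixes \<mu> :: "'a::euclidean_space measure"
  assumes s: "0 < s" and \<mu>: "\<mu> \<in> Mplus_s s"
  shows "integrable \<mu> (Phi_weight s)"
proof (rule Bochner_Integration.integrable_bound)
  let ?p = "real DIM('a) + 2 * s"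
  have sets [measurable_cong]: "sets \<mu> = sets borel" using \<mu> by (simp add: Mplus_s_def)
  have "integrable \<mu> (\<lambda>y. (1 + norm y) powr (- ?p))"
    using \<mu> by (intro integrableI_bounded) (auto simp: Mplus_s_def)
  then show "integrable \<mu> (\<lambda>y. 2048 powr (?p / 8) * (1 + norm y) powr (- ?p))"
    by (rule integrable_mult_right)
  show "Phi_weight s \<in> borel_measurable \<mu>"
    unfolding Phi_weight_def[abs_def] by measurable
  have "\<bar>Phi_weight s y\<bar> \<le> 2048 powr (?p / 8) * (1 + norm y) powr (- ?p)" for y :: 'a
    using Phi_weight_bounds[OF s, of y] order_trans[OF powr_ge_zero Phi_weight_bounds(1)[OF s, of y]]
    by simp
  then show "AE y in \<mu>. norm (Phi_weight s y) \<le> norm (2048 powr (?p / 8) * (1 + norm y) powr (- ?p))"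
    by simp
qed

section \<open>The pointwise estimate for solutions\<close>

theorem theorem7p1:
  fixes s :: real
  assumes "0 < s" and "s < 1"
  shows "\<exists>C::real. \<forall>\<mu>0 :: 'a::euclidean_space measure. \<mu>0 \<in> Mplus_s s \<longrightarrow>
           (\<forall>t>0. \<forall>x::'a.
              frac_heat_sol s \<mu>0 t x
                \<le> C * Phi_norm s \<mu>0 * (t powr (- real DIM('a) / (2 * s)) + t)
                    * (1 + norm x) powr (real DIM('a) + 2 * s))"
proof -
  define p where "p = real DIM('a) + 2 * s"
  have p: "p > 0" using assms by (simp add: p_def add_nonneg_pos)
  have pos: "0 < (1 + norm v) powr p" for v :: 'a
    using norm_ge_zero[of v] by (simp del: norm_ge_zero)
  obtain C where C: "C \<ge> 0" "\<And>t (z::'a). t > 0 \<Longrightarrow> frac_heat_kernel s t z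
    \<le> C * (t powr (- real DIM('a) / (2 * s)) + t) * (1 + norm z) powr (- p)"
    using frac_heat_kernel_le[OF assms, where 'a = 'a] unfolding p_def by blast
  have "frac_heat_sol s \<mu> t x \<le> C * Phi_norm s \<mu> * (t powr (- real DIM('a) / (2 * s)) + t) * (1 + norm x) powr p"
    if \<mu>: "\<mu> \<in> Mplus_s s" and t: "t > 0" for \<mu> :: "'a measure" and t x
  proof -
    define M where "M = C * (t powr (- real DIM('a) / (2 * s)) + t)"
    have M: "M \<ge> 0" using C(1) t by (simp add: M_def)
    have kernel: "frac_heat_kernel s t (x - y) \<le> M * (1 + norm x) powr p * Phi_weight s y" for y
    proof -
      \<comment> \<open>This multiplicative triangle inequality trades decay in \<open>x - y\<close>
        for decay in \<open>y\<close>, at the price of the growth factor in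
        \<open>x\<close>.\<close>
      have "1 + norm y \<le> 1 + (norm x + norm (x - y))"
        using norm_triangle_ineq4[of x "x - y"] by simp
      also have "\<dots> \<le> (1 + norm x) * (1 + norm (x - y))"
        by (simp add: algebra_simps)
      finally have "(1 + norm y) powr p \<le> ((1 + norm x) * (1 + norm (x - y))) powr p"
        using p by (intro powr_mono2) auto
      then have "(1 + norm (x - y)) powr (- p) \<le> (1 + norm x) powr p * (1 + norm y) powr (- p)"
        by (simp add: powr_mult powr_minus_divide pos_le_divide_eq[OF pos] pos_divide_le_eq[OF pos])
      also have "\<dots> \<le> (1 + norm x) powr p * Phi_weight s y"
        using Phi_weight_bounds(1)[OF assms(1), of y] by (intro mult_left_mono) (auto simp: p_def)
      finally have "M * (1 + norm (x - y)) powr (- p) \<le> M * ((1 + norm x) powr p * Phi_weight s y)"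
        using M by (rule mult_left_mono)
      with C(2)[OF t, of "x - y"] show ?thesis by (simp add: M_def mult_ac)
    qed
    have "frac_heat_sol s \<mu> t x \<le> (\<integral>y. M * (1 + norm x) powr p * Phi_weight s y \<partial>\<mu>)"
      unfolding frac_heat_sol_def
    \<comment> \<open>The majorant is integrable and nonnegative, so the comparison also covers the
      default value 0 of the Bochner integral on the left.\<close>
    proof (rule integral_mono')
      show "integrable \<mu> (\<lambda>y. M * (1 + norm x) powr p * Phi_weight s y)"
        using Phi_weight_integrable[OF assms(1) \<mu>] by (rule integrable_mult_right)
      show "0 \<le> M * (1 + norm x) powr p * Phi_weight s y" for y
        using M by (simp add: Phi_weight_def)
    qed (rule kernel)
    also have "\<dots> = M * (1 + norm x) powr p * Phi_norm s \<mu>"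
      by (simp add: Phi_norm_def)
    finally show ?thesis by (simp add: M_def mult_ac)
  qed
  then show ?thesis unfolding p_def by blast
qed

end
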